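(* Let $G=(V,E)$ be a strongly connected directed graph, let $v\in V$, and let $C$ be a $2$-vertex-connected component of $G$. Then, in the dominator tree $DT(v)$ of the flowgraph $G(v)$, either there is a vertex $w\notin C$ such that every element of $C$ is a child of $w$, or there is a vertex $w\in C$ such that every element of $C\setminus\{w\}$ is a child of $w$.
   Context: For $U\subseteq V$, $G[U]$ is the induced subgraph. $G$ is $2$-vertex-connected if it has at least $3$ vertices and $G[V\setminus X]$ is strongly connected for every $X\subset V$ with $|X|<2$; the $2$-vertex-connected components of $G$ are its maximal $2$-vertex-connected subgraphs (identified with vertex sets $C$, subgraph $G[C]$). The flowgraph $G(v)$ is $G$ with start vertex $v$. A vertex $w$ dominates $u$ in $G(v)$ if every path from $v$ to $u$ contains $w$. Every $u\neq v$ has a unique immediate dominator $\mathrm{imd}(u)$: a dominator of $u$ different from $u$ that is dominated by all other dominators of $u$ different from $u$. The edges $(\mathrm{imd}(u),u)$ form the dominator tree $DT(v)$ rooted at $v$; the children (direct successors) of $w$ in $DT(v)$ are the vertices $u$ with $\mathrm{imd}(u)=w$. *)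

theory Defs
  imports "Graph_Theory.Graph_Theory"
begin

text \<open>
  Digraphs are those of \<^theory>\<open>Graph_Theory.Digraph\<close>: loops and parallel arcs are permitted,
  and finiteness is not presupposed. Since \<^const>\<open>card\<close> is \<open>0\<close> on infinite sets, infinite
  vertex sets are mentioned explicitly.
\<close>

definition two_vertex_connected :: "('a,'b) pre_digraph \<Rightarrow> bool" where
  "two_vertex_connected G \<longleftrightarrow>
     (infinite (verts G) \<or> 3 \<le> card (verts G)) \<and>
     (\<forall>X. X \<subset> verts G \<and> finite X \<and> card X < 2 \<longrightarrow> strongly_connected (G \<restriction> (verts G - X)))"

lemma arc_mono_two_vertex_connected: "arc_mono (two_vertex_connected :: ('a,'b) pre_digraph \<Rightarrow> bool)"
  unfolding arc_mono_def
proof (intro allI impI)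
  fix H1 H2 :: "('a,'b) pre_digraph"
  assume a: "two_vertex_connected H1 \<and> subgraph H1 H2 \<and> verts H1 = verts H2"
  then have "arcs_ends (H1 \<restriction> S) \<subseteq> arcs_ends (H2 \<restriction> S)" for S
    unfolding arcs_ends_def arc_to_ends_def subgraph_def compatible_def induce_subgraph_def
    by fastforce
  then have "u \<rightarrow>\<^sup>*\<^bsub>H2 \<restriction> S\<^esub> w" if "u \<rightarrow>\<^sup>*\<^bsub>H1 \<restriction> S\<^esub> w" for S u w
    using that unfolding reachable_def induce_subgraph_verts by (rule rtrancl_on_mono[OF _ subset_refl])
  then have "strongly_connected (H2 \<restriction> S)" if "strongly_connected (H1 \<restriction> S)" for S
    using that unfolding strongly_connected_def by simp
  moreover have "verts H1 = verts H2" and "two_vertex_connected H1" using a by blast+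
  ultimately show "two_vertex_connected H2"
    unfolding two_vertex_connected_def by metis
qed

context pre_digraph
begin

definition two_vertex_connected_components :: "'a set set" where
  "two_vertex_connected_components = {verts H | H. max_subgraph two_vertex_connected H}"

text \<open>
  In the following, \<open>v\<close> is the start vertex of the flowgraph. The name avoids a clash with
  \<^const>\<open>dominates\<close>, which the library uses for the arc relation.
\<close>

definition flow_dominates :: "'a \<Rightarrow> 'a \<Rightarrow> 'a \<Rightarrow> bool" where
  "flow_dominates v w u \<longleftrightarrow> (\<forall>p. apath v p u \<longrightarrow> w \<in> set (awalk_verts v p))"

definition is_imd :: "'a \<Rightarrow> 'a \<Rightarrow> 'a \<Rightarrow> bool" where
  "is_imd v u w \<longleftrightarrow>
     flow_dominates v w u \<and> w \<noteq> u \<and>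
     (\<forall>x. flow_dominates v x u \<and> x \<noteq> u \<and> x \<noteq> w \<longrightarrow> flow_dominates v x w)"

definition imd :: "'a \<Rightarrow> 'a \<Rightarrow> 'a" where
  "imd v u = (THE w. is_imd v u w)"

definition dominator_tree :: "'a \<Rightarrow> 'a pair_pre_digraph" where
  "dominator_tree v = \<lparr> pverts = verts G, parcs = {(imd v u, u) | u. u \<in> verts G - {v}} \<rparr>"

definition dt_children :: "'a \<Rightarrow> 'a \<Rightarrow> 'a set" where
  "dt_children v w = {u. w \<rightarrow>\<^bsub>with_proj (dominator_tree v)\<^esub> u}"

end

context wf_digraph
begin

text \<open>A component \<open>C\<close> is the vertex set of exactly one maximal subgraph, namely \<open>G \<restriction> C\<close>.\<close>

lemma max_two_vertex_connected_induced:
  assumes "max_subgraph two_vertex_connected H"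
  shows "H = G \<restriction> verts H"
proof -
  have "induced_subgraph H G"
    using assms arc_mono_two_vertex_connected by (rule induced_subgraphI_arc_mono)
  then show ?thesis
    by (auto simp: induced_subgraph_def subgraph_def compatible_def induce_subgraph_def)
qed

lemma flow_dominates_awalk:
  "flow_dominates v w u \<longleftrightarrow> (\<forall>p. awalk v p u \<longrightarrow> w \<in> set (awalk_verts v p))"
proof
  assume d: "flow_dominates v w u"
  show "\<forall>p. awalk v p u \<longrightarrow> w \<in> set (awalk_verts v p)"
  proof (intro allI impI)
    fix p assume p: "awalk v p u"
    have "w \<in> set (awalk_verts v (awalk_to_apath p))"
      using d apath_awalk_to_apath[OF p] unfolding flow_dominates_def by blast
    then show "w \<in> set (awalk_verts v p)"
      using set_awalk_verts[OF p] awalk_to_apath_subset[OF p]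
        set_awalk_verts[OF awalkI_apath[OF apath_awalk_to_apath[OF p]]] by auto
  qed
qed (auto simp: flow_dominates_def apath_def)

lemma ex1_imd:
  assumes "strongly_connected G" "v \<in> verts G" "u \<in> verts G" "u \<noteq> v"
  shows "\<exists>!w. is_imd v u w"
proof (rule ex_ex1I)
  let ?P = "\<lambda>r. \<exists>w. flow_dominates v w u \<and> w \<noteq> u \<and> awalk w r u"
  have reach: "\<exists>p. awalk v p y" if "y \<in> verts G" for y
    using assms that unfolding strongly_connected_def by (auto simp: reachable_awalk)
  obtain p where p: "awalk v p u" using reach assms by blast
  have "flow_dominates v v u" unfolding flow_dominates_awalk
    using hd_in_awalk_verts(1) by blast
  with p assms have "?P p" by blast
  then obtain r where r: "?P r" and rmin: "\<And>s. ?P s \<Longrightarrow> length r \<le> length s"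
    using ex_has_least_nat[of ?P p length] by auto
  then obtain w where w: "flow_dominates v w u" "w \<noteq> u" "awalk w r u" by blast
  have "flow_dominates v x w" if x: "flow_dominates v x u" "x \<noteq> u" "x \<noteq> w" for x
  proof (rule ccontr)
    assume "\<not> flow_dominates v x w"
    then obtain q where q: "awalk v q w" "x \<notin> set (awalk_verts v q)"
      unfolding flow_dominates_awalk by blast
    have "awalk v (q @ r) u" using q w by simp
    then have "x \<in> set (awalk_verts v (q @ r))" using x unfolding flow_dominates_awalk by blast
    then have "x \<in> set (awalk_verts w r)"
      using q w \<open>awalk v (q @ r) u\<close> by (auto simp: set_awalk_verts_append)
    then obtain r1 r2 where "r = r1 @ r2" "awalk w r1 x" "awalk x r2 u"
      using awalk_decomp[OF w(3)] by blast
    moreover have "r1 \<noteq> []" using calculation x by (auto simp: awalk_Nil_iff)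
    ultimately show False using x rmin[of r2] by auto
  qed
  with w show "\<exists>w. is_imd v u w" unfolding is_imd_def by blast
next
  fix a b assume ab: "is_imd v u a" "is_imd v u b"
  show "a = b"
  proof (rule ccontr)
    assume ne: "a \<noteq> b"
    let ?P = "\<lambda>p. awalk v p a \<or> awalk v p b"
    have d: "flow_dominates v a b" "flow_dominates v b a" using ab ne unfolding is_imd_def by auto
    obtain p where "awalk v p u" using assms unfolding strongly_connected_def
      by (auto simp: reachable_awalk)
    then obtain p0 where "awalk v p0 a"
      using ab awalk_decomp[of v p u a] unfolding is_imd_def flow_dominates_awalk by blast
    then obtain p where p: "?P p" and pmin: "\<And>s. ?P s \<Longrightarrow> length p \<le> length s"
      using ex_has_least_nat[of ?P p0 length] by blast
    have no: False if y: "awalk v p y" "flow_dominates v x y" "x \<noteq> y" and x: "x = a \<or> x = b" for x y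
    proof -
      have "x \<in> set (awalk_verts v p)" using y(1,2) unfolding flow_dominates_awalk by simp
      from awalk_decomp[OF y(1) this]
      obtain r1 r2 where r: "p = r1 @ r2" "awalk v r1 x" "awalk x r2 y" by blast
      have "r2 \<noteq> []" using r(3) y(3) by (auto simp: awalk_Nil_iff)
      moreover have "length p \<le> length r1" using pmin r(2) x by metis
      ultimately show False using r(1) by simp
    qed
    from p show False
      using no[of a b] no[of b a] d ne by blast
  qed
qed

end

end

theory Submission
  imports Defs
begin

text \<open>
  If \<open>z\<close> is distinct from two vertices \<open>x\<close>, \<open>y\<close> of \<open>C\<close>, then \<open>x\<close> reaches \<open>y\<close> inside \<open>C\<close> avoiding
  \<open>z\<close>, so \<open>z\<close> dominates \<open>x\<close> iff it dominates \<open>y\<close>. Hence a vertex \<open>w\<close> of \<open>C\<close> that dominates another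
  vertex of \<open>C\<close> dominates all of them, and every further dominator of one of these also dominates
  \<open>w\<close>, so \<open>w\<close> is their common immediate dominator. If there is no such \<open>w\<close>, then all proper
  dominators of vertices of \<open>C\<close> lie outside \<open>C\<close>, and all vertices of \<open>C\<close> share them.
\<close>

context wf_digraph
begin

lemma flow_dominates_source_iff:
  assumes "v \<in> verts G"
  shows "flow_dominates v w v \<longleftrightarrow> w = v"
proof
  assume "flow_dominates v w v"
  moreover have "awalk v [] v" using assms by (simp add: awalk_Nil_iff)
  ultimately show "w = v" unfolding flow_dominates_awalk by fastforce
next
  assume "w = v"
  then show "flow_dominates v w v"
    unfolding flow_dominates_awalk using hd_in_awalk_verts(1) by blast
qed

text \<open>Reachability rules out vacuous domination: if no walk leads from \<open>v\<close> to
  \<open>u\<close>, then every \<open>w\<close> dominates \<open>u\<close>.\<close>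

lemma flow_dominates_in_verts:
  assumes "flow_dominates v w u" "v \<rightarrow>\<^sup>*\<^bsub>G\<^esub> u"
  shows "w \<in> verts G"
proof -
  obtain p where p: "awalk v p u" using assms(2) by (auto simp: reachable_awalk)
  then have "w \<in> set (awalk_verts v p)" using assms(1) unfolding flow_dominates_awalk by blast
  then show ?thesis using awalk_verts_in_verts[of v p] p by (auto simp: awalk_def)
qed

text \<open>Any walk from \<open>v\<close> to \<open>x\<close> extends through \<open>K\<close> to a
  walk to \<open>y\<close>. This must meet \<open>z\<close>, and its part in \<open>K\<close> does
  not.\<close>

lemma flow_dominates_if_reachable_avoiding:
  assumes "flow_dominates v z y" "subgraph K G" "z \<notin> verts K" "x \<rightarrow>\<^sup>*\<^bsub>K\<^esub> y"
  shows "flow_dominates v z x"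
  unfolding flow_dominates_awalk
proof (intro allI impI)
  fix p assume p: "awalk v p x"
  interpret K: wf_digraph K using assms(2) by (simp add: subgraph_def)
  obtain q where q: "K.awalk x q y" using assms(4) by (auto simp: K.reachable_awalk)
  have qG: "awalk x q y" using subgraph_awalk_imp_awalk[OF q assms(2)] .
  have "set (K.awalk_verts x q) \<subseteq> verts K"
    using K.awalk_verts_in_verts[of x q] q by (auto simp: K.awalk_def)
  moreover have "K.awalk_verts x q = awalk_verts x q"
    using assms(2) compatible_awalk_verts[of G K] by (simp add: subgraph_def)
  ultimately have "z \<notin> set (awalk_verts x q)" using assms(3) by auto
  moreover have pq: "awalk v (p @ q) y" using p qG by simp
  then have "z \<in> set (awalk_verts v (p @ q))"
    using assms(1) unfolding flow_dominates_awalk by blast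
  ultimately show "z \<in> set (awalk_verts v p)"
    using p qG pq by (auto simp: set_awalk_verts_append)
qed

lemma flow_dominates_two_vertex_connected:
  assumes H: "two_vertex_connected H" "subgraph H G"
    and xy: "x \<in> verts H" "y \<in> verts H" and z: "z \<noteq> x" "z \<noteq> y"
    and dom: "flow_dominates v z y"
  shows "flow_dominates v z x"
proof -
  interpret H: wf_digraph H using H(2) by (simp add: subgraph_def)
  \<comment> \<open>Only subsets of \<open>verts H\<close> may be deleted, but \<open>z\<close> may
    lie outside \<open>H\<close>; then \<open>?X\<close> is empty and \<open>?K\<close> still avoids
    \<open>z\<close>.\<close>
  let ?X = "verts H \<inter> {z}"
  let ?K = "H \<restriction> (verts H - ?X)"
  have "?X \<subset> verts H" "finite ?X" "card ?X < 2"
    using xy z by (auto intro: le_less_trans[OF card_mono[of "{z}"]])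
  then have "strongly_connected ?K"
    using H(1) unfolding two_vertex_connected_def by blast
  then have "x \<rightarrow>\<^sup>*\<^bsub>?K\<^esub> y"
    using xy z unfolding strongly_connected_def by auto
  moreover have "subgraph ?K G"
    using H.subgraph_induce_subgraphI[of "verts H - ?X"] H(2) subgraph_trans by blast
  ultimately show ?thesis
    using flow_dominates_if_reachable_avoiding[OF dom, of ?K x] by simp
qed

lemma dt_childrenI:
  assumes "strongly_connected G" "v \<in> verts G" "u \<in> verts G" "u \<noteq> v" "is_imd v u w"
  shows "u \<in> dt_children v w"
proof -
  have "imd v u = w"
    unfolding imd_def using ex1_imd[OF assms(1-4)] assms(5) by (rule the1_equality)
  then show ?thesis
    using assms(3,4) by (auto simp: dt_children_def dominator_tree_def)
qed

theorem dominator_tree_two_vertex_connected: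
  assumes sc: "strongly_connected G" and v: "v \<in> verts G"
    and H: "two_vertex_connected H" "subgraph H G"
  shows "(\<exists>w \<in> verts G - verts H. \<forall>u \<in> verts H. u \<in> dt_children v w) \<or>
         (\<exists>w \<in> verts H. \<forall>u \<in> verts H - {w}. u \<in> dt_children v w)"
proof -
  have HG: "verts H \<subseteq> verts G" using H(2) by blast
  note transfer = flow_dominates_two_vertex_connected[OF H]
  show ?thesis
  proof (cases "\<exists>w\<in>verts H. \<exists>u\<in>verts H - {w}. flow_dominates v w u")
    case True
    then obtain w u0 where w: "w \<in> verts H" "u0 \<in> verts H" "u0 \<noteq> w" "flow_dominates v w u0"
      by blast
    have "u \<in> dt_children v w" if u: "u \<in> verts H" "u \<noteq> w" for u
    proof (rule dt_childrenI[OF sc v])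
      have dom: "flow_dominates v w u" using transfer[OF u(1) w(2)] u w by metis
      \<comment> \<open>Only \<open>v\<close> itself dominates \<open>v\<close>, so
        \<open>u = v\<close> would force \<open>w = u\<close>.\<close>
      then show "u \<noteq> v" using flow_dominates_source_iff[OF v] u by metis
      \<comment> \<open>A dominator of \<open>u\<close> other than \<open>u\<close> and
        \<open>w\<close> differs from two vertices of \<open>H\<close>, so it also dominates
        \<open>w\<close>.\<close>
      show "is_imd v u w"
        unfolding is_imd_def using dom u transfer[OF w(1) u(1)] by blast
    qed (use u HG in blast)
    then show ?thesis using w(1) by blast
  next
    case False
    have "verts H \<noteq> {}" using H(1) unfolding two_vertex_connected_def by auto
    then obtain u where u: "u \<in> verts H" by blast
    \<comment> \<open>The source dominates every vertex. If it were in \<open>H\<close>, which has a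
      second vertex, the first case would apply.\<close>
    have vH: "v \<notin> verts H"
    proof
      assume "v \<in> verts H"
      moreover have "\<not> verts H \<subseteq> {v}"
        using H(1) card_mono[of "{v}" "verts H"] finite_subset[of "verts H" "{v}"]
        unfolding two_vertex_connected_def by auto
      moreover have "flow_dominates v v x" for x
        unfolding flow_dominates_awalk using hd_in_awalk_verts(1) by blast
      ultimately show False using False by blast
    qed
    \<comment> \<open>The immediate dominator of one arbitrary vertex \<open>u\<close> serves for
      all of \<open>H\<close>.\<close>
    obtain w where w: "is_imd v u w" using ex1_imd[OF sc v, of u] u HG vH by blast
    then have wu: "flow_dominates v w u" "w \<noteq> u" unfolding is_imd_def by auto
    have wH: "w \<notin> verts H" using False wu u by blast
    have wG: "w \<in> verts G"
      using flow_dominates_in_verts[OF wu(1)] sc v u HG unfolding strongly_connected_def by blast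
    have "u' \<in> dt_children v w" if u': "u' \<in> verts H" for u'
    proof (rule dt_childrenI[OF sc v])
      show "u' \<noteq> v" using u' vH by blast
      have "flow_dominates v w u'" using transfer[OF u' u] wu u' wH by metis
      moreover have "flow_dominates v x w"
        if x: "flow_dominates v x u'" "x \<noteq> u'" "x \<noteq> w" for x
      proof -
        \<comment> \<open>By the case assumption \<open>x\<close> lies outside \<open>H\<close>, so
          its domination passes from \<open>u'\<close> to \<open>u\<close>, whose immediate
          dominator is \<open>w\<close>.\<close>
        have "x \<notin> verts H" using False x u' by blast
        then have "flow_dominates v x u" "x \<noteq> u" using transfer[OF u u'] x u by metis+
        then show ?thesis using w x(3) unfolding is_imd_def by blast
      qed
      ultimately show "is_imd v u' w" unfolding is_imd_def using u' wH by blast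
    qed (use u' HG in blast)
    then show ?thesis using wG wH by blast
  qed
qed

end

theorem theorem3:
  fixes G :: "('a,'b) pre_digraph" and v :: 'a and C :: "'a set"
  assumes "wf_digraph G"
    and "strongly_connected G"
    and "v \<in> verts G"
    and "C \<in> pre_digraph.two_vertex_connected_components G"
  shows "(\<exists>w \<in> verts G - C. \<forall>u \<in> C. u \<in> pre_digraph.dt_children G v w) \<or>
         (\<exists>w \<in> C. \<forall>u \<in> C - {w}. u \<in> pre_digraph.dt_children G v w)"
proof -
  interpret wf_digraph G by fact
  obtain H where "C = verts H" "max_subgraph two_vertex_connected H"
    using assms(4) unfolding two_vertex_connected_components_def by blast
  then show ?thesis
    using dominator_tree_two_vertex_connected[OF assms(2,3), of H]
    unfolding max_subgraph_def by blast
qed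

end
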